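(* Let $n\ge 1$ and let $f,g:\{0,1\}^n\to\{0,1\}$ be increasing. For every $t\in\mathbb{R}$, $$2\sum_{\substack{S,T\subseteq[n]\\ |S\cap T|\text{ odd}}}\hat f(S)^2\,\hat g(T)^2\;\le\; t^2\,\mathrm{Cov}(f,g)+(1-t)^2\,\mathrm{Cov}(f,g^* ).$$
   Context: $[n]=\{1,\dots,n\}$. The cube $\{0,1\}^n$ carries the uniform probability measure, $X$ denotes a uniform random point of $\{0,1\}^n$, and $\mathbb{E}$ is taken with respect to it. A function $\{0,1\}^n\to\{0,1\}$ is increasing if it is nondecreasing in each coordinate. $\mathrm{Cov}(f,g)=\mathbb{E}[fg]-\mathbb{E}[f]\mathbb{E}[g]$. The dual of $g$ is $g^*(x)=1-g(1-x)$, where $1-x$ is the coordinatewise complement of $x$. The Fourier coefficients are $\hat f(S)=\mathbb{E}[f(X)\chi_S(X)]$ with $\chi_S(x)=(-1)^{\sum_{i\in S}x_i}$ for $S\subseteq[n]$, and similarly for $g$. The sum is over ordered pairs $(S,T)$ of subsets of $[n]$ with $|S\cap T|$ odd. *)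

theory Defs
  imports "HOL-Probability.Probability"
begin

(* Points of {0,1}^n are extensional functions on {1..n} (value undefined elsewhere), so that
   "cube n" has exactly 2^n elements. *)
definition cube :: "nat \<Rightarrow> (nat \<Rightarrow> nat) set" where
  "cube n = {1..n} \<rightarrow>\<^sub>E {0, 1}"

definition cube_expectation :: "nat \<Rightarrow> ((nat \<Rightarrow> nat) \<Rightarrow> real) \<Rightarrow> real" where
  "cube_expectation n h = measure_pmf.expectation (pmf_of_set (cube n)) h"

definition cube_cov ::
  "nat \<Rightarrow> ((nat \<Rightarrow> nat) \<Rightarrow> real) \<Rightarrow> ((nat \<Rightarrow> nat) \<Rightarrow> real) \<Rightarrow> real" where
  "cube_cov n f g =
     cube_expectation n (\<lambda>x. f x * g x) - cube_expectation n f * cube_expectation n g"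

definition cube_increasing :: "nat \<Rightarrow> ((nat \<Rightarrow> nat) \<Rightarrow> real) \<Rightarrow> bool" where
  "cube_increasing n f \<longleftrightarrow>
     (\<forall>x\<in>cube n. \<forall>i\<in>{1..n}. f (x(i := 0)) \<le> f (x(i := 1)))"

definition cube_compl :: "nat \<Rightarrow> (nat \<Rightarrow> nat) \<Rightarrow> (nat \<Rightarrow> nat)" where
  "cube_compl n x = (\<lambda>i\<in>{1..n}. 1 - x i)"

definition cube_dual :: "nat \<Rightarrow> ((nat \<Rightarrow> nat) \<Rightarrow> real) \<Rightarrow> (nat \<Rightarrow> nat) \<Rightarrow> real" where
  "cube_dual n g = (\<lambda>x. 1 - g (cube_compl n x))"

definition cube_char :: "nat set \<Rightarrow> (nat \<Rightarrow> nat) \<Rightarrow> real" where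
  "cube_char S x = (-1) ^ (\<Sum>i\<in>S. x i)"

definition fourier_coeff :: "nat \<Rightarrow> ((nat \<Rightarrow> nat) \<Rightarrow> real) \<Rightarrow> nat set \<Rightarrow> real" where
  "fourier_coeff n f S = cube_expectation n (\<lambda>x. f x * cube_char S x)"

end

theory Submission
  imports Defs
begin

text \<open>
  Identify \<open>{0,1}\<^sup>n\<close> with the subsets of \<open>[n]\<close>, and let the up-sets \<open>F\<close> and \<open>G\<close> be the supports of
  \<open>f\<close> and \<open>g\<close>. Let \<open>\<Pi>\<close> be the projection onto the span of the normalised Walsh functions \<open>\<chi>\<^sub>X\<close> with
  \<open>X \<in> F\<close>. Its compression to the functions living on \<open>G\<close> is the symmetric matrix with entries
  \<open>M(Y, Y') = f^(Y \<triangle> Y')\<close>, \<open>Y, Y' \<in> G\<close>, where \<open>f^\<close> denotes the Fourier transform. As the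
  squares of the coefficients of \<open>g\<close> are the transform of its autocorrelation, the left-hand side is
  \<open>E f E g - 2\<^sup>-\<^sup>n \<parallel>M\<parallel>\<^sup>2\<close> with the Frobenius norm. The diagonal of \<open>M\<close> is constantly \<open>E f\<close>, so expanding
  \<open>\<parallel>M - t I\<parallel>\<^sup>2\<close> shows that right minus left is \<open>2\<^sup>-\<^sup>n\<close> times
  \<open>\<parallel>M - t I\<parallel>\<^sup>2 - t\<^sup>2 |G - F| - (1 - t)\<^sup>2 |{Y \<in> G. [n] - Y \<in> F}|\<close>.
  Hence it is enough that \<open>M\<close> has the eigenvalue 0 with multiplicity at least \<open>|G - F|\<close> and the
  eigenvalue 1 with multiplicity at least \<open>|{Y \<in> G. [n] - Y \<in> F}|\<close>: each eigenvalue \<open>\<mu>\<close> contributes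
  \<open>(\<mu> - t)\<^sup>2\<close> to \<open>\<parallel>M - t I\<parallel>\<^sup>2\<close>.

  Monotonicity supplies the eigenvectors. For \<open>Z \<in> G - F\<close> the indicator of \<open>{Y. Z \<subseteq> Y}\<close> lives on \<open>G\<close>,
  and its Walsh transform lives on the subsets of \<open>Z\<close>, none of which lies in \<open>F\<close>; so \<open>M\<close> kills it
  (lemma \<open>compression_kernel\<close>). For \<open>Z \<in> G\<close> with \<open>[n] - Z \<in> F\<close> the same indicator times \<open>(-1)\<close> to the
  power \<open>|Y|\<close> lives on \<open>G\<close>, and its transform lives on the supersets of \<open>[n] - Z\<close>, all of which lie in
  \<open>F\<close>; so \<open>M\<close> fixes it (lemma \<open>compression_fixpoint\<close>). Both families are triangular with respect to
  inclusion, hence linearly independent.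
\<close>

section \<open>Eigenvalue multiplicities and the Frobenius norm\<close>

lemma bessel_inequality_on:
  fixes e :: "'i \<Rightarrow> 'a \<Rightarrow> real"
  assumes "finite I"
    and orth: "\<And>i j. i \<in> I \<Longrightarrow> j \<in> I \<Longrightarrow> (\<Sum>y\<in>G. e i y * e j y) = (if i = j then 1 else 0)"
  shows "(\<Sum>i\<in>I. (\<Sum>y\<in>G. r y * e i y)\<^sup>2) \<le> (\<Sum>y\<in>G. (r y)\<^sup>2)"
proof -
  define c where "c i = (\<Sum>y\<in>G. r y * e i y)" for i
  have cross: "(\<Sum>y\<in>G. r y * (\<Sum>i\<in>I. c i * e i y)) = (\<Sum>i\<in>I. (c i)\<^sup>2)"
  proof -
    have "(\<Sum>y\<in>G. r y * (\<Sum>i\<in>I. c i * e i y)) = (\<Sum>y\<in>G. \<Sum>i\<in>I. c i * (r y * e i y))"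
      by (simp add: sum_distrib_left mult_ac)
    also have "\<dots> = (\<Sum>i\<in>I. c i * (\<Sum>y\<in>G. r y * e i y))"
      by (subst sum.swap) (simp add: sum_distrib_left)
    finally show ?thesis by (simp add: c_def power2_eq_square)
  qed
  have square: "(\<Sum>y\<in>G. (\<Sum>i\<in>I. c i * e i y)\<^sup>2) = (\<Sum>i\<in>I. (c i)\<^sup>2)"
  proof -
    have "(\<Sum>y\<in>G. (\<Sum>i\<in>I. c i * e i y)\<^sup>2)
        = (\<Sum>y\<in>G. \<Sum>i\<in>I. \<Sum>j\<in>I. c i * c j * (e i y * e j y))"
      by (simp add: power2_eq_square sum_product mult_ac)
    also have "\<dots> = (\<Sum>i\<in>I. \<Sum>y\<in>G. \<Sum>j\<in>I. c i * c j * (e i y * e j y))"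
      by (rule sum.swap)
    also have "\<dots> = (\<Sum>i\<in>I. \<Sum>j\<in>I. c i * c j * (\<Sum>y\<in>G. e i y * e j y))"
      by (intro sum.cong refl, subst sum.swap) (simp add: sum_distrib_left)
    also have "\<dots> = (\<Sum>i\<in>I. \<Sum>j\<in>I. if i = j then c i * c j else 0)"
      by (intro sum.cong refl) (simp add: orth)
    also have "\<dots> = (\<Sum>i\<in>I. (c i)\<^sup>2)"
      using \<open>finite I\<close> by (simp add: power2_eq_square)
    finally show ?thesis .
  qed
  have "0 \<le> (\<Sum>y\<in>G. (r y - (\<Sum>i\<in>I. c i * e i y))\<^sup>2)"
    by (intro sum_nonneg) simp
  also have "\<dots> = (\<Sum>y\<in>G. (r y)\<^sup>2) - 2 * (\<Sum>y\<in>G. r y * (\<Sum>i\<in>I. c i * e i y))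
                 + (\<Sum>y\<in>G. (\<Sum>i\<in>I. c i * e i y)\<^sup>2)"
    by (simp add: power2_diff sum.distrib sum_subtractf sum_distrib_left mult.assoc)
  also have "\<dots> = (\<Sum>y\<in>G. (r y)\<^sup>2) - (\<Sum>i\<in>I. (c i)\<^sup>2)"
    by (simp add: cross square)
  finally show ?thesis by (simp add: c_def)
qed

text \<open>
  The vector \<open>(M - t I) e\<^sub>i\<close> equals \<open>(\<mu>\<^sub>i - t) e\<^sub>i\<close>, and its entries are the inner products of \<open>e\<^sub>i\<close> with
  the rows of \<open>M - t I\<close>; summing Bessel's inequality over the rows gives the bound.
\<close>
lemma frobenius_ge_orthonormal_eigenvectors:
  fixes M :: "'a \<Rightarrow> 'a \<Rightarrow> real" and e :: "'i \<Rightarrow> 'a \<Rightarrow> real" and ev :: "'i \<Rightarrow> real" and t :: real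
  assumes "finite I" "finite G"
    and orth: "\<And>i j. i \<in> I \<Longrightarrow> j \<in> I \<Longrightarrow> (\<Sum>y\<in>G. e i y * e j y) = (if i = j then 1 else 0)"
    and eigen: "\<And>i x. i \<in> I \<Longrightarrow> x \<in> G \<Longrightarrow> (\<Sum>y\<in>G. M x y * e i y) = ev i * e i x"
  shows "(\<Sum>i\<in>I. (ev i - t)\<^sup>2) \<le> (\<Sum>x\<in>G. \<Sum>y\<in>G. (M x y - (if x = y then t else 0))\<^sup>2)"
proof -
  have row: "(\<Sum>y\<in>G. (M x y - (if x = y then t else 0)) * e i y) = (ev i - t) * e i x"
    if "i \<in> I" "x \<in> G" for i x
  proof -
    have "(\<Sum>y\<in>G. (M x y - (if x = y then t else 0)) * e i y)
        = (\<Sum>y\<in>G. M x y * e i y) - (\<Sum>y\<in>G. if x = y then t * e i y else 0)"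
      unfolding sum_subtractf[symmetric] by (intro sum.cong refl) (simp add: left_diff_distrib)
    then show ?thesis
      using that \<open>finite G\<close> by (simp add: eigen left_diff_distrib)
  qed
  have "(\<Sum>i\<in>I. (ev i - t)\<^sup>2) = (\<Sum>i\<in>I. (ev i - t)\<^sup>2 * (\<Sum>x\<in>G. e i x * e i x))"
    by (simp add: orth)
  also have "\<dots> = (\<Sum>i\<in>I. \<Sum>x\<in>G. (\<Sum>y\<in>G. (M x y - (if x = y then t else 0)) * e i y)\<^sup>2)"
    by (simp add: row power_mult_distrib sum_distrib_left power2_eq_square[of "e _ _"])
  also have "\<dots> = (\<Sum>x\<in>G. \<Sum>i\<in>I. (\<Sum>y\<in>G. (M x y - (if x = y then t else 0)) * e i y)\<^sup>2)"
    by (rule sum.swap)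
  also have "\<dots> \<le> (\<Sum>x\<in>G. \<Sum>y\<in>G. (M x y - (if x = y then t else 0))\<^sup>2)"
    by (intro sum_mono bessel_inequality_on assms)
  finally show ?thesis .
qed

text \<open>
  Linear subspaces are needed inside the function type \<open>'a \<Rightarrow> real\<close>, equipped with the inner product
  \<open>\<Sum>y\<in>G. u y * v y\<close>, which ignores the values outside \<open>G\<close>.
\<close>
definition lin_closed :: "('a \<Rightarrow> real) set \<Rightarrow> bool" where
  "lin_closed V \<longleftrightarrow> (\<forall>u\<in>V. \<forall>v\<in>V. \<forall>a b. (\<lambda>y. a * u y + b * v y) \<in> V)"

lemma lin_closedD: "lin_closed V \<Longrightarrow> u \<in> V \<Longrightarrow> v \<in> V \<Longrightarrow> (\<lambda>y. a * u y + b * v y) \<in> V"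
  by (simp add: lin_closed_def)

lemma lin_closed_diff_sum:
  assumes V: "lin_closed V" and "finite I" "v \<in> V" "\<And>i. i \<in> I \<Longrightarrow> e i \<in> V"
  shows "(\<lambda>y. v y - (\<Sum>i\<in>I. c i * e i y)) \<in> V"
  using assms(2,4)
proof (induction I rule: finite_induct)
  case empty
  then show ?case using \<open>v \<in> V\<close> by simp
next
  case (insert i I)
  then have "(\<lambda>y. v y - (\<Sum>i\<in>I. c i * e i y)) \<in> V" "e i \<in> V" by auto
  then have "(\<lambda>y. 1 * (v y - (\<Sum>i\<in>I. c i * e i y)) + (- c i) * e i y) \<in> V"
    by (rule lin_closedD[OF V])
  then show ?case using insert.hyps by (simp add: algebra_simps)
qed

text \<open>
  This is Gram-Schmidt for a triangular family, with the triangular shape doing the work of linear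
  independence. A point \<open>z\<close> of greatest rank is split off: all the other given vectors vanish there, so
  the induction hypothesis applies to the subspace \<open>{v \<in> V. v z = 0}\<close>. Subtracting from the vector
  attached to \<open>z\<close> its projection onto the resulting family does not change its value at \<open>z\<close>, hence
  leaves a nonzero vector to normalise.
\<close>
lemma triangular_orthonormal_family:
  fixes V :: "('a \<Rightarrow> real) set" and rank :: "'a \<Rightarrow> 'b::linorder"
  assumes "finite G" and "finite Z" and "Z \<subseteq> G" and "lin_closed V"
    and "\<And>z. z \<in> Z \<Longrightarrow> \<exists>v\<in>V. v z \<noteq> 0 \<and> (\<forall>y\<in>Z. y \<noteq> z \<and> rank z \<le> rank y \<longrightarrow> v y = 0)"
  shows "\<exists>e. (\<forall>z\<in>Z. e z \<in> V) \<and>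
             (\<forall>y\<in>Z. \<forall>z\<in>Z. (\<Sum>x\<in>G. e y x * e z x) = (if y = z then 1 else 0))"
  using assms(2-5)
proof (induction Z arbitrary: V rule: finite_ranking_induct[where f = rank])
  case empty
  then show ?case by simp
next
  case (insert z Z)
  show ?case
  proof (cases "z \<in> Z")
    case True
    then show ?thesis using insert by (simp add: insert_absorb)
  next
    case False
    define V' where "V' = {v \<in> V. v z = 0}"
    have closed': "lin_closed V'"
      using insert.prems(2) by (auto simp: lin_closed_def V'_def)
    have "\<exists>v\<in>V'. v y \<noteq> 0 \<and> (\<forall>x\<in>Z. x \<noteq> y \<and> rank y \<le> rank x \<longrightarrow> v x = 0)" if yZ: "y \<in> Z" for y
    proof -
      obtain v where v: "v \<in> V" "v y \<noteq> 0"
        "\<forall>x\<in>insert z Z. x \<noteq> y \<and> rank y \<le> rank x \<longrightarrow> v x = 0"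
        using insert.prems(3)[of y] yZ by blast
      have "v z = 0" using v(3) insert.hyps(2)[OF yZ] yZ False by auto
      then show ?thesis using v by (auto simp: V'_def)
    qed
    then have "\<exists>e. (\<forall>y\<in>Z. e y \<in> V') \<and>
        (\<forall>x\<in>Z. \<forall>y\<in>Z. (\<Sum>w\<in>G. e x w * e y w) = (if x = y then 1 else 0))"
      using insert.prems(1) by (intro insert.IH closed') auto
    then obtain e where e: "\<And>y. y \<in> Z \<Longrightarrow> e y \<in> V'"
      and orth: "\<And>x y. x \<in> Z \<Longrightarrow> y \<in> Z \<Longrightarrow> (\<Sum>w\<in>G. e x w * e y w) = (if x = y then 1 else 0)"
      by blast
    obtain v where v: "v \<in> V" "v z \<noteq> 0"
      using insert.prems(3)[of z] by blast
    \<comment> \<open>the component of the new vector orthogonal to the family already built\<close>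
    define c where "c y = (\<Sum>x\<in>G. v x * e y x)" for y
    define w where "w x = v x - (\<Sum>y\<in>Z. c y * e y x)" for x
    have wV: "w \<in> V"
      unfolding w_def using e
      by (intro lin_closed_diff_sum insert.prems insert.hyps v) (auto simp: V'_def)
    have "w z = v z"
      using e by (simp add: w_def V'_def)
    have w_orth: "(\<Sum>x\<in>G. w x * e y x) = 0" if "y \<in> Z" for y
    proof -
      have "(\<Sum>x\<in>G. w x * e y x) = c y - (\<Sum>x\<in>G. \<Sum>i\<in>Z. c i * (e i x * e y x))"
        by (simp add: w_def c_def[of y] left_diff_distrib sum_subtractf sum_distrib_right mult.assoc)
      also have "(\<Sum>x\<in>G. \<Sum>i\<in>Z. c i * (e i x * e y x)) = (\<Sum>i\<in>Z. c i * (\<Sum>x\<in>G. e i x * e y x))"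
        by (subst sum.swap) (simp add: sum_distrib_left)
      also have "\<dots> = (\<Sum>i\<in>Z. if i = y then c i else 0)"
        by (intro sum.cong refl) (simp add: orth that)
      finally show ?thesis using that insert.hyps(1) by simp
    qed
    define s where "s = (\<Sum>x\<in>G. w x * w x)"
    have "0 < s"
    proof -
      have "z \<in> G" using insert.prems(1) by simp
      moreover have "w z * w z > 0"
        using \<open>w z = v z\<close> v(2) by (simp add: zero_less_mult_iff) linarith
      ultimately show ?thesis
        unfolding s_def using \<open>finite G\<close> by (intro sum_pos2[of _ z]) auto
    qed
    define u where "u x = w x / sqrt s" for x
    have "(\<lambda>x. (1 / sqrt s) * w x + 0 * w x) \<in> V"
      by (rule lin_closedD[OF insert.prems(2) wV wV])
    then have uV: "u \<in> V" by (simp add: u_def[abs_def])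
    have uu: "(\<Sum>x\<in>G. u x * u x) = 1"
      using \<open>0 < s\<close> by (simp add: u_def sum_divide_distrib[symmetric] s_def[symmetric])
    have ue: "(\<Sum>x\<in>G. u x * e y x) = 0" if "y \<in> Z" for y
      using w_orth[OF that] by (simp add: u_def sum_divide_distrib[symmetric])
    then have eu: "(\<Sum>x\<in>G. e y x * u x) = 0" if "y \<in> Z" for y
      using that by (simp add: mult.commute)
    show ?thesis
      by (rule exI[of _ "e(z := u)"])
        (use False uV uu ue eu e orth in \<open>auto simp: V'_def\<close>)
  qed
qed

text \<open>
  Eigenspaces of a symmetric matrix for different eigenvalues are orthogonal, so orthonormal
  families in the kernel and in the space of fixed vectors combine to a single one.
\<close>
lemma frobenius_ge_triangular_eigenvectors:
  fixes M :: "'a \<Rightarrow> 'a \<Rightarrow> real" and rank :: "'a \<Rightarrow> 'b::linorder" and t :: real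
  assumes "finite G" and "Z0 \<subseteq> G" and "Z1 \<subseteq> G"
    and sym: "\<And>x y. M x y = M y x"
    and ker: "\<And>z. z \<in> Z0 \<Longrightarrow> \<exists>v. (\<forall>x\<in>G. (\<Sum>y\<in>G. M x y * v y) = 0) \<and>
                v z \<noteq> 0 \<and> (\<forall>y\<in>Z0. y \<noteq> z \<and> rank z \<le> rank y \<longrightarrow> v y = 0)"
    and fixp: "\<And>z. z \<in> Z1 \<Longrightarrow> \<exists>v. (\<forall>x\<in>G. (\<Sum>y\<in>G. M x y * v y) = v x) \<and>
                v z \<noteq> 0 \<and> (\<forall>y\<in>Z1. y \<noteq> z \<and> rank z \<le> rank y \<longrightarrow> v y = 0)"
  shows "t\<^sup>2 * card Z0 + (1 - t)\<^sup>2 * card Z1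
         \<le> (\<Sum>x\<in>G. \<Sum>y\<in>G. (M x y - (if x = y then t else 0))\<^sup>2)"
proof -
  have fin: "finite Z0" "finite Z1"
    using assms(1-3) finite_subset by auto
  define V :: "real \<Rightarrow> ('a \<Rightarrow> real) set"
    where "V a = {v. \<forall>x\<in>G. (\<Sum>y\<in>G. M x y * v y) = a * v x}" for a
  have closed: "lin_closed (V a)" for a
  proof -
    have "(\<Sum>y\<in>G. M x y * (b * u y + c * v y))
        = b * (\<Sum>y\<in>G. M x y * u y) + c * (\<Sum>y\<in>G. M x y * v y)" for b c u v x
      by (simp add: sum_distrib_left sum.distrib distrib_left mult_ac)
    then show ?thesis by (auto simp: lin_closed_def V_def algebra_simps)
  qed
  have "\<exists>e. (\<forall>z\<in>Z0. e z \<in> V 0) \<and>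
      (\<forall>y\<in>Z0. \<forall>z\<in>Z0. (\<Sum>x\<in>G. e y x * e z x) = (if y = z then 1 else 0))"
    using ker by (intro triangular_orthonormal_family[where rank = rank] assms fin closed)
      (simp add: V_def)
  then obtain e0 where e0: "\<And>z. z \<in> Z0 \<Longrightarrow> e0 z \<in> V 0"
    and orth0: "\<And>y z. y \<in> Z0 \<Longrightarrow> z \<in> Z0 \<Longrightarrow> (\<Sum>x\<in>G. e0 y x * e0 z x) = (if y = z then 1 else 0)"
    by blast
  have "\<exists>e. (\<forall>z\<in>Z1. e z \<in> V 1) \<and>
      (\<forall>y\<in>Z1. \<forall>z\<in>Z1. (\<Sum>x\<in>G. e y x * e z x) = (if y = z then 1 else 0))"
    using fixp by (intro triangular_orthonormal_family[where rank = rank] assms fin closed)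
      (simp add: V_def)
  then obtain e1 where e1: "\<And>z. z \<in> Z1 \<Longrightarrow> e1 z \<in> V 1"
    and orth1: "\<And>y z. y \<in> Z1 \<Longrightarrow> z \<in> Z1 \<Longrightarrow> (\<Sum>x\<in>G. e1 y x * e1 z x) = (if y = z then 1 else 0)"
    by blast
  have orth01: "(\<Sum>x\<in>G. u x * v x) = 0" if "u \<in> V 0" "v \<in> V 1" for u v
  proof -
    have "(\<Sum>x\<in>G. u x * v x) = (\<Sum>x\<in>G. u x * (\<Sum>y\<in>G. M x y * v y))"
      using that(2) by (simp add: V_def)
    also have "\<dots> = (\<Sum>y\<in>G. \<Sum>x\<in>G. v y * (M y x * u x))"
      by (subst sum.swap) (simp add: sum_distrib_left mult_ac sym)
    also have "\<dots> = (\<Sum>y\<in>G. v y * (\<Sum>x\<in>G. M y x * u x))"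
      by (simp add: sum_distrib_left)
    also have "\<dots> = 0" using that(1) by (simp add: V_def)
    finally show ?thesis .
  qed
  then have orth10: "(\<Sum>x\<in>G. v x * u x) = 0" if "u \<in> V 0" "v \<in> V 1" for u v
    using that by (simp add: mult.commute)
  let ?ev = "case_sum (\<lambda>_. 0) (\<lambda>_. 1) :: 'a + 'a \<Rightarrow> real"
  have "(\<Sum>i\<in>Z0 <+> Z1. (?ev i - t)\<^sup>2)
      \<le> (\<Sum>x\<in>G. \<Sum>y\<in>G. (M x y - (if x = y then t else 0))\<^sup>2)"
  proof (rule frobenius_ge_orthonormal_eigenvectors[where e = "case_sum e0 e1"])
    show "(\<Sum>y\<in>G. case_sum e0 e1 i y * case_sum e0 e1 j y) = (if i = j then 1 else 0)"
      if "i \<in> Z0 <+> Z1" "j \<in> Z0 <+> Z1" for i j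
      using that e0 e1 by (auto simp: orth0 orth1 orth01 orth10 split: if_splits)
    show "(\<Sum>y\<in>G. M x y * case_sum e0 e1 i y) = ?ev i * case_sum e0 e1 i x"
      if "i \<in> Z0 <+> Z1" "x \<in> G" for i x
      using that e0 e1 by (auto simp: V_def)
  qed (use fin \<open>finite G\<close> in auto)
  then show ?thesis
    using fin by (simp add: sum.Plus mult.commute)
qed

section \<open>Walsh functions on the subsets of a finite set\<close>

definition walsh :: "'a set \<Rightarrow> 'a set \<Rightarrow> real" where
  "walsh X Y = (-1) ^ card (X \<inter> Y)"

text \<open>This is the Fourier coefficient at \<open>S\<close> of the indicator function of the family \<open>F\<close>.\<close>
definition walsh_coeff :: "'a set \<Rightarrow> 'a set set \<Rightarrow> 'a set \<Rightarrow> real" where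
  "walsh_coeff A F S = (\<Sum>X\<in>F. walsh S X) / 2 ^ card A"

lemma walsh_commute: "walsh X Y = walsh Y X"
  by (simp add: walsh_def Int_commute)

lemma walsh_eq_prod: "finite X \<Longrightarrow> walsh X Y = (\<Prod>i\<in>X. if i \<in> Y then -1 else 1)"
  by (simp add: walsh_def prod.If_cases)

lemma walsh_mult: "finite X \<Longrightarrow> walsh X Y * walsh X Y' = walsh X (sym_diff Y Y')"
  by (simp add: walsh_eq_prod prod.distrib[symmetric]) (rule prod.cong, auto)

text \<open>
  Toggling the membership of \<open>i\<close> pairs the sets between \<open>Z\<close> and \<open>A\<close> into pairs with opposite values.
  All vanishing statements about Walsh transforms below come from this.
\<close>
lemma sum_interval_cancel:
  fixes h :: "'a set \<Rightarrow> real"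
  assumes "i \<in> A" "i \<notin> Z" and flip: "\<And>Y. Y \<subseteq> A \<Longrightarrow> i \<notin> Y \<Longrightarrow> h (insert i Y) = - h Y"
  shows "(\<Sum>Y | Z \<subseteq> Y \<and> Y \<subseteq> A. h Y) = 0"
proof -
  define s where "s Y = (if i \<in> Y then Y - {i} else insert i Y)" for Y
  have "h (s Y) = - h Y" if "Y \<subseteq> A" for Y
  proof -
    have "Y - {i} \<subseteq> A" using that by auto
    then show ?thesis
      using flip[of Y] flip[of "Y - {i}"] that by (auto simp: s_def insert_absorb)
  qed
  then have "(\<Sum>Y | Z \<subseteq> Y \<and> Y \<subseteq> A. h Y) = (\<Sum>Y | Z \<subseteq> Y \<and> Y \<subseteq> A. - h Y)"
    by (intro sum.reindex_bij_witness[of _ s s]) (use assms(1,2) in \<open>auto simp: s_def\<close>)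
  then show ?thesis by (simp add: sum_negf)
qed

lemma sum_walsh_Pow:
  assumes "finite A" "D \<subseteq> A"
  shows "(\<Sum>X\<in>Pow A. walsh X D) = (if D = {} then 2 ^ card A else 0)"
proof (cases "D = {}")
  case True
  then show ?thesis using assms by (simp add: walsh_def card_Pow)
next
  case False
  then obtain i where "i \<in> D" by auto
  have "(\<Sum>X | {} \<subseteq> X \<and> X \<subseteq> A. walsh X D) = 0"
  proof (rule sum_interval_cancel)
    show "walsh (insert i Y) D = - walsh Y D" if "Y \<subseteq> A" "i \<notin> Y" for Y
      using that \<open>i \<in> D\<close> finite_subset[OF that(1) assms(1)] by (simp add: walsh_def)
  qed (use \<open>i \<in> D\<close> assms in auto)
  then show ?thesis using False by (simp add: Pow_def)
qed

lemma walsh_orthogonal: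
  assumes "finite A" "Y \<subseteq> A" "Y' \<subseteq> A"
  shows "(\<Sum>X\<in>Pow A. walsh X Y * walsh X Y') = (if Y = Y' then 2 ^ card A else 0)"
proof -
  have "(\<Sum>X\<in>Pow A. walsh X Y * walsh X Y') = (\<Sum>X\<in>Pow A. walsh X (sym_diff Y Y'))"
    by (intro sum.cong refl walsh_mult) (use assms finite_subset in auto)
  also have "\<dots> = (if Y = Y' then 2 ^ card A else 0)"
    using assms by (subst sum_walsh_Pow) auto
  finally show ?thesis .
qed

text \<open>
  The squared coefficients of an indicator function are the Walsh transform of its
  autocorrelation, which counts the pairs in \<open>G\<close> with a given symmetric difference.
\<close>
lemma sum_walsh_coeff_sq:
  assumes "finite A" "G \<subseteq> Pow A" "S \<subseteq> A"
  shows "(\<Sum>T\<in>Pow A. walsh S T * (walsh_coeff A G T)\<^sup>2)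
       = (\<Sum>Y\<in>G. \<Sum>Y'\<in>G. if S = sym_diff Y Y' then 1 else 0) / 2 ^ card A"
proof -
  let ?N = "2 ^ card A :: real"
  have "(\<Sum>T\<in>Pow A. walsh S T * (walsh_coeff A G T)\<^sup>2)
      = (\<Sum>T\<in>Pow A. \<Sum>Y\<in>G. \<Sum>Y'\<in>G. walsh T S * (walsh T Y * walsh T Y')) / ?N\<^sup>2"
    unfolding walsh_coeff_def power_divide power2_eq_square[of "sum _ _"] sum_product
      walsh_commute[of S] sum_divide_distrib[of _ "Pow A"]
    by (simp add: sum_distrib_left)
  also have "(\<Sum>T\<in>Pow A. \<Sum>Y\<in>G. \<Sum>Y'\<in>G. walsh T S * (walsh T Y * walsh T Y'))
      = (\<Sum>T\<in>Pow A. \<Sum>Y\<in>G. \<Sum>Y'\<in>G. walsh T S * walsh T (sym_diff Y Y'))"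
    by (intro sum.cong refl arg_cong2[where f = "(*)"] walsh_mult)
      (use assms finite_subset in auto)
  also have "\<dots> = (\<Sum>Y\<in>G. \<Sum>T\<in>Pow A. \<Sum>Y'\<in>G. walsh T S * walsh T (sym_diff Y Y'))"
    by (rule sum.swap)
  also have "\<dots> = (\<Sum>Y\<in>G. \<Sum>Y'\<in>G. \<Sum>T\<in>Pow A. walsh T S * walsh T (sym_diff Y Y'))"
    by (intro sum.cong refl sum.swap)
  also have "\<dots> = (\<Sum>Y\<in>G. \<Sum>Y'\<in>G. ?N * (if S = sym_diff Y Y' then 1 else 0))"
  proof (intro sum.cong refl)
    fix Y Y' assume "Y \<in> G" "Y' \<in> G"
    then have "sym_diff Y Y' \<subseteq> A" using assms(2) by auto
    then show "(\<Sum>T\<in>Pow A. walsh T S * walsh T (sym_diff Y Y'))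
        = ?N * (if S = sym_diff Y Y' then 1 else 0)"
      by (simp add: walsh_orthogonal assms)
  qed
  finally show ?thesis
    by (simp add: sum_distrib_left[symmetric] power2_eq_square)
qed

lemma walsh_parseval:
  assumes "finite A" "G \<subseteq> Pow A"
  shows "(\<Sum>T\<in>Pow A. (walsh_coeff A G T)\<^sup>2) = card G / 2 ^ card A"
proof -
  have "finite G" using assms finite_subset by auto
  have eq: "{} = sym_diff Y Y' \<longleftrightarrow> Y = Y'" for Y Y' :: "'a set" by auto
  have "(\<Sum>T\<in>Pow A. (walsh_coeff A G T)\<^sup>2) = (\<Sum>T\<in>Pow A. walsh {} T * (walsh_coeff A G T)\<^sup>2)"
    by (simp add: walsh_def)
  also have "\<dots> = (\<Sum>Y\<in>G. \<Sum>Y'\<in>G. if Y = Y' then 1 else 0) / 2 ^ card A"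
    using assms by (subst sum_walsh_coeff_sq) (simp_all only: eq empty_subsetI)
  finally show ?thesis using \<open>finite G\<close> by simp
qed

text \<open>
  Since \<open>walsh S T\<close> is \<open>-1\<close> exactly for the pairs with \<open>S \<inter> T\<close> of odd size, this turns the sum over
  such pairs into the squared Frobenius norm of the compressed matrix.
\<close>
lemma sum_sign_walsh_coeff_sq:
  assumes "finite A" "F \<subseteq> Pow A" "G \<subseteq> Pow A"
  shows "(\<Sum>S\<in>Pow A. \<Sum>T\<in>Pow A. walsh S T * ((walsh_coeff A F S)\<^sup>2 * (walsh_coeff A G T)\<^sup>2))
       = (\<Sum>Y\<in>G. \<Sum>Y'\<in>G. (walsh_coeff A F (sym_diff Y Y'))\<^sup>2) / 2 ^ card A"
proof -
  have "(\<Sum>S\<in>Pow A. \<Sum>T\<in>Pow A. walsh S T * ((walsh_coeff A F S)\<^sup>2 * (walsh_coeff A G T)\<^sup>2))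
      = (\<Sum>S\<in>Pow A. (walsh_coeff A F S)\<^sup>2 * (\<Sum>T\<in>Pow A. walsh S T * (walsh_coeff A G T)\<^sup>2))"
    by (simp add: sum_distrib_left mult_ac)
  also have "\<dots> = (\<Sum>S\<in>Pow A. \<Sum>Y\<in>G. \<Sum>Y'\<in>G.
       if S = sym_diff Y Y' then (walsh_coeff A F S)\<^sup>2 else 0) / 2 ^ card A"
    unfolding sum_divide_distrib[of _ "Pow A"]
    by (intro sum.cong refl)
      (simp add: sum_walsh_coeff_sq assms sum_distrib_left if_distrib[of "(*) _"] cong: if_cong)
  also have "(\<Sum>S\<in>Pow A. \<Sum>Y\<in>G. \<Sum>Y'\<in>G.
       if S = sym_diff Y Y' then (walsh_coeff A F S)\<^sup>2 else 0)
     = (\<Sum>Y\<in>G. \<Sum>S\<in>Pow A. \<Sum>Y'\<in>G. if S = sym_diff Y Y' then (walsh_coeff A F S)\<^sup>2 else 0)"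
    by (rule sum.swap)
  also have "\<dots> = (\<Sum>Y\<in>G. \<Sum>Y'\<in>G. \<Sum>S\<in>Pow A.
       if S = sym_diff Y Y' then (walsh_coeff A F S)\<^sup>2 else 0)"
    by (intro sum.cong refl sum.swap)
  also have "\<dots> = (\<Sum>Y\<in>G. \<Sum>Y'\<in>G. (walsh_coeff A F (sym_diff Y Y'))\<^sup>2)"
  proof (intro sum.cong refl)
    fix Y Y' assume "Y \<in> G" "Y' \<in> G"
    then have "sym_diff Y Y' \<in> Pow A" using assms(3) by auto
    then show "(\<Sum>S\<in>Pow A. if S = sym_diff Y Y' then (walsh_coeff A F S)\<^sup>2 else 0)
        = (walsh_coeff A F (sym_diff Y Y'))\<^sup>2"
      using assms(1) by (subst sum.delta) auto
  qed
  finally show ?thesis .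
qed

section \<open>The compression attached to two up-sets\<close>

definition upset_in :: "'a set \<Rightarrow> 'a set set \<Rightarrow> bool" where
  "upset_in A F \<longleftrightarrow> F \<subseteq> Pow A \<and> (\<forall>X Y. X \<in> F \<and> X \<subseteq> Y \<and> Y \<subseteq> A \<longrightarrow> Y \<in> F)"

text \<open>
  The matrix acts by taking the Walsh transform, restricting it to \<open>F\<close>, and transforming back.
  It is applied here to functions supported on the supersets of a member \<open>Z\<close> of \<open>G\<close>; as \<open>G\<close> is an
  up-set, the restriction to \<open>G\<close> is then invisible and the inner sum runs over a full interval.
\<close>
lemma compression_apply:
  assumes "finite A" "F \<subseteq> Pow A" "upset_in A G" "Z \<in> G" "Y \<subseteq> A"
  shows "(\<Sum>Y'\<in>G. walsh_coeff A F (sym_diff Y Y') * (if Z \<subseteq> Y' then c Y' else 0))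
       = (\<Sum>X\<in>F. walsh X Y * (\<Sum>Y' | Z \<subseteq> Y' \<and> Y' \<subseteq> A. walsh X Y' * c Y')) / 2 ^ card A"
proof -
  have "finite G" and up: "{Y'\<in>G. Z \<subseteq> Y'} = {Y'. Z \<subseteq> Y' \<and> Y' \<subseteq> A}"
    using assms finite_subset[of G "Pow A"] by (auto simp: upset_in_def)
  have "walsh_coeff A F (sym_diff Y Y') = (\<Sum>X\<in>F. walsh X Y * walsh X Y') / 2 ^ card A" for Y'
    unfolding walsh_coeff_def using assms
    by (intro arg_cong2[where f = "(/)"] sum.cong refl)
      (subst walsh_mult, auto simp: walsh_commute dest: finite_subset)
  then have "(\<Sum>Y'\<in>G. walsh_coeff A F (sym_diff Y Y') * (if Z \<subseteq> Y' then c Y' else 0))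
      = (\<Sum>Y'\<in>G. if Z \<subseteq> Y' then (\<Sum>X\<in>F. walsh X Y * (walsh X Y' * c Y')) / 2 ^ card A else 0)"
    by (intro sum.cong refl) (simp add: sum_distrib_right mult.assoc)
  also have "\<dots> = (\<Sum>Y' | Z \<subseteq> Y' \<and> Y' \<subseteq> A. (\<Sum>X\<in>F. walsh X Y * (walsh X Y' * c Y')) / 2 ^ card A)"
    unfolding up[symmetric] using \<open>finite G\<close> by (simp add: sum.inter_filter)
  also have "\<dots> = (\<Sum>X\<in>F. walsh X Y * (\<Sum>Y' | Z \<subseteq> Y' \<and> Y' \<subseteq> A. walsh X Y' * c Y')) / 2 ^ card A"
    by (simp add: sum_divide_distrib[symmetric] sum_distrib_left) (rule sum.swap)
  finally show ?thesis .
qed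

text \<open>
  No \<open>X \<in> F\<close> is contained in \<open>Z\<close>, since \<open>F\<close> is an up-set without \<open>Z\<close>. Toggling an element of \<open>X - Z\<close>
  therefore shows that the transform of the indicator vanishes on \<open>F\<close>.
\<close>
lemma compression_kernel:
  assumes "finite A" "upset_in A F" "upset_in A G" "Z \<in> G" "Z \<notin> F" "Y \<subseteq> A"
  shows "(\<Sum>Y'\<in>G. walsh_coeff A F (sym_diff Y Y') * (if Z \<subseteq> Y' then 1 else 0)) = 0"
proof -
  have "(\<Sum>Y' | Z \<subseteq> Y' \<and> Y' \<subseteq> A. walsh X Y' * 1) = 0" if "X \<in> F" for X
  proof -
    have "X \<subseteq> A" "\<not> X \<subseteq> Z"
      using that assms(2-5) by (auto simp: upset_in_def)
    then obtain i where i: "i \<in> X" "i \<notin> Z" "i \<in> A" by auto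
    show ?thesis
    proof (rule sum_interval_cancel[OF i(3,2)])
      show "walsh X (insert i Y) * 1 = - (walsh X Y * 1)" if "Y \<subseteq> A" "i \<notin> Y" for Y
        using that i(1) finite_subset[OF that(1) assms(1)] by (simp add: walsh_def)
    qed
  qed
  then show ?thesis
    using assms by (subst compression_apply) (auto simp: upset_in_def)
qed

text \<open>
  The transform at \<open>X\<close> is a sum of the signs \<open>(-1)\<close> to the power \<open>|Y' - X|\<close>, so it vanishes unless \<open>X\<close>
  contains \<open>A - Z\<close>, and then \<open>X \<in> F\<close>. Restricting the transform to \<open>F\<close> thus loses nothing, and
  Fourier inversion returns the original function.
\<close>
lemma compression_fixpoint:
  assumes "finite A" "upset_in A F" "upset_in A G" "Z \<in> G" "A - Z \<in> F" "Y \<subseteq> A"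
  defines "c \<equiv> \<lambda>Y. (-1 :: real) ^ card Y"
  shows "(\<Sum>Y'\<in>G. walsh_coeff A F (sym_diff Y Y') * (if Z \<subseteq> Y' then c Y' else 0))
       = (if Z \<subseteq> Y then c Y else 0)"
proof -
  let ?J = "{Y'. Z \<subseteq> Y' \<and> Y' \<subseteq> A}"
  have FA: "F \<subseteq> Pow A" using assms(2) by (simp add: upset_in_def)
  have vanish: "(\<Sum>Y'\<in>?J. walsh X Y' * c Y') = 0" if "X \<in> Pow A - F" for X
  proof -
    have "\<not> A - Z \<subseteq> X"
      using that assms(2,5) by (auto simp: upset_in_def)
    then obtain i where i: "i \<in> A" "i \<notin> Z" "i \<notin> X" by auto
    show ?thesis
    proof (rule sum_interval_cancel[OF i(1,2)])
      show "walsh X (insert i Y) * c (insert i Y) = - (walsh X Y * c Y)" if "Y \<subseteq> A" "i \<notin> Y" for Y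
        using that i(3) finite_subset[OF that(1) assms(1)] by (simp add: walsh_def c_def)
    qed
  qed
  have "(\<Sum>Y'\<in>G. walsh_coeff A F (sym_diff Y Y') * (if Z \<subseteq> Y' then c Y' else 0))
      = (\<Sum>X\<in>F. walsh X Y * (\<Sum>Y'\<in>?J. walsh X Y' * c Y')) / 2 ^ card A"
    using assms FA by (intro compression_apply) auto
  also have "(\<Sum>X\<in>F. walsh X Y * (\<Sum>Y'\<in>?J. walsh X Y' * c Y'))
      = (\<Sum>X\<in>Pow A. walsh X Y * (\<Sum>Y'\<in>?J. walsh X Y' * c Y'))"
    using assms(1) FA vanish by (intro sum.mono_neutral_left) auto
  also have "\<dots> = (\<Sum>Y'\<in>?J. (\<Sum>X\<in>Pow A. walsh X Y * walsh X Y') * c Y')"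
    unfolding sum_distrib_left sum_distrib_right mult.assoc by (rule sum.swap)
  also have "\<dots> = (\<Sum>Y'\<in>?J. if Y' = Y then 2 ^ card A * c Y' else 0)"
    using assms by (intro sum.cong refl) (simp add: walsh_orthogonal)
  also have "\<dots> = (if Z \<subseteq> Y then 2 ^ card A * c Y else 0)"
    using assms(1,6) by (subst sum.delta) auto
  finally show ?thesis by simp
qed

text \<open>
  A vector supported on the supersets of \<open>Z\<close> vanishes at every other set with at most \<open>|Z|\<close>
  elements; ranking sets by decreasing size makes both families of eigenvectors triangular.
\<close>
lemma upset_compression_frobenius:
  fixes t :: real
  assumes "finite A" and F: "upset_in A F" and G: "upset_in A G"
  shows "t\<^sup>2 * card (G - F) + (1 - t)\<^sup>2 * card {Y\<in>G. A - Y \<in> F}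
       \<le> (\<Sum>Y\<in>G. \<Sum>Y'\<in>G. (walsh_coeff A F (sym_diff Y Y') - (if Y = Y' then t else 0))\<^sup>2)"
proof (rule frobenius_ge_triangular_eigenvectors[where rank = "\<lambda>Y. - int (card Y)"])
  have GA: "Y \<subseteq> A" if "Y \<in> G" for Y using that G by (auto simp: upset_in_def)
  show "finite G" using assms finite_subset[of G "Pow A"] by (auto simp: upset_in_def)
  show "G - F \<subseteq> G" "{Y\<in>G. A - Y \<in> F} \<subseteq> G" by auto
  show "walsh_coeff A F (sym_diff Y Y') = walsh_coeff A F (sym_diff Y' Y)" for Y Y'
    by (simp add: Un_commute)
  have triangular: "\<not> Z \<subseteq> Y" if "Y \<in> G" "Y \<noteq> Z" "- int (card Z) \<le> - int (card Y)" for Y Z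
    using that GA finite_subset[OF GA assms(1)] card_subset_eq[of Y Z] card_mono[of Y Z] by force
  show "\<exists>v. (\<forall>Y\<in>G. (\<Sum>Y'\<in>G. walsh_coeff A F (sym_diff Y Y') * v Y') = 0) \<and> v Z \<noteq> 0 \<and>
      (\<forall>Y\<in>G - F. Y \<noteq> Z \<and> - int (card Z) \<le> - int (card Y) \<longrightarrow> v Y = 0)" if "Z \<in> G - F" for Z
    using that triangular GA compression_kernel[OF assms]
    by (intro exI[of _ "\<lambda>Y. if Z \<subseteq> Y then 1 else 0"]) auto
  show "\<exists>v. (\<forall>Y\<in>G. (\<Sum>Y'\<in>G. walsh_coeff A F (sym_diff Y Y') * v Y') = v Y) \<and> v Z \<noteq> 0 \<and>
      (\<forall>Y\<in>{Y\<in>G. A - Y \<in> F}. Y \<noteq> Z \<and> - int (card Z) \<le> - int (card Y) \<longrightarrow> v Y = 0)"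
    if "Z \<in> {Y\<in>G. A - Y \<in> F}" for Z
    using that triangular GA compression_fixpoint[OF assms]
    by (intro exI[of _ "\<lambda>Y. if Z \<subseteq> Y then (-1) ^ card Y else 0"]) auto
qed

text \<open>
  Here \<open>P\<close> is the uniform probability of a family. What remains is to expand the Frobenius norm of
  \<open>M - t I\<close>, using \<open>(1 - t)\<^sup>2 - t\<^sup>2 = 1 - 2 t\<close>.
\<close>
lemma upset_inequality:
  fixes t :: real
  assumes "finite A" and F: "upset_in A F" and G: "upset_in A G"
  defines "P \<equiv> \<lambda>\<A>. real (card \<A>) / 2 ^ card A"
  shows "2 * (\<Sum>(S, T) \<in> {(S, T). S \<subseteq> A \<and> T \<subseteq> A \<and> odd (card (S \<inter> T))}.
             (walsh_coeff A F S)\<^sup>2 * (walsh_coeff A G T)\<^sup>2)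
         \<le> t\<^sup>2 * (P (F \<inter> G) - P F * P G) + (1 - t)\<^sup>2 * (P F * P G - P {Y\<in>G. A - Y \<in> F})"
proof -
  let ?N = "2 ^ card A :: real"
  let ?w = "\<lambda>S T. (walsh_coeff A F S)\<^sup>2 * (walsh_coeff A G T)\<^sup>2"
  define Q where "Q = (\<Sum>Y\<in>G. \<Sum>Y'\<in>G. (walsh_coeff A F (sym_diff Y Y'))\<^sup>2)"
  have sub: "F \<subseteq> Pow A" "G \<subseteq> Pow A" using F G by (auto simp: upset_in_def)
  then have fin: "finite F" "finite G" using assms(1) finite_subset[of _ "Pow A"] by auto
  have lhs: "2 * (\<Sum>(S, T) \<in> {(S, T). S \<subseteq> A \<and> T \<subseteq> A \<and> odd (card (S \<inter> T))}. ?w S T)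
      = P F * P G - Q / ?N"
  proof -
    \<comment> \<open>\<open>1 - walsh S T\<close> is 2 on the pairs with odd intersection and 0 on the others\<close>
    have "(\<Sum>(S, T) \<in> {(S, T). S \<subseteq> A \<and> T \<subseteq> A \<and> odd (card (S \<inter> T))}. 2 * ?w S T)
        = (\<Sum>(S, T) \<in> Pow A \<times> Pow A. ?w S T - walsh S T * ?w S T)"
      using assms(1) by (intro sum.mono_neutral_cong_left) (auto simp: walsh_def)
    also have "\<dots> = (\<Sum>S\<in>Pow A. \<Sum>T\<in>Pow A. ?w S T) - (\<Sum>S\<in>Pow A. \<Sum>T\<in>Pow A. walsh S T * ?w S T)"
      by (simp add: sum.cartesian_product[symmetric] sum_subtractf)
    also have "(\<Sum>S\<in>Pow A. \<Sum>T\<in>Pow A. ?w S T) = P F * P G"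
      unfolding sum_product[symmetric] using assms(1) sub by (simp add: walsh_parseval P_def)
    also have "(\<Sum>S\<in>Pow A. \<Sum>T\<in>Pow A. walsh S T * ?w S T) = Q / ?N"
      using assms(1) sub by (simp add: sum_sign_walsh_coeff_sq Q_def)
    finally show ?thesis by (simp add: sum_distrib_left split_def)
  qed
  have diag: "walsh_coeff A F {} = P F"
    by (simp add: walsh_coeff_def walsh_def P_def)
  have "(\<Sum>Y\<in>G. \<Sum>Y'\<in>G. (walsh_coeff A F (sym_diff Y Y') - (if Y = Y' then t else 0))\<^sup>2)
      = (\<Sum>Y\<in>G. \<Sum>Y'\<in>G. (walsh_coeff A F (sym_diff Y Y'))\<^sup>2 + (if Y = Y' then t\<^sup>2 - 2 * t * P F else 0))"
    by (intro sum.cong refl) (auto simp: power2_diff diag)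
  also have "\<dots> = Q + card G * (t\<^sup>2 - 2 * t * P F)"
    using fin by (simp add: sum.distrib Q_def)
  finally have "t\<^sup>2 * card (G - F) + (1 - t)\<^sup>2 * card {Y\<in>G. A - Y \<in> F}
      \<le> Q + card G * (t\<^sup>2 - 2 * t * P F)"
    using upset_compression_frobenius[OF assms(1-3), of t] by simp
  then have "(t\<^sup>2 * card (G - F) + (1 - t)\<^sup>2 * card {Y\<in>G. A - Y \<in> F}) / ?N
      \<le> (Q + card G * (t\<^sup>2 - 2 * t * P F)) / ?N"
    by (intro divide_right_mono) auto
  moreover have "real (card (G - F)) = real (card G) - real (card (F \<inter> G))"
    using fin by (simp add: card_Diff_subset_Int Int_commute of_nat_diff card_mono)
  ultimately have "t\<^sup>2 * (P G - P (F \<inter> G)) + (1 - t)\<^sup>2 * P {Y\<in>G. A - Y \<in> F}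
      \<le> Q / ?N + P G * (t\<^sup>2 - 2 * t * P F)"
    by (simp add: P_def add_divide_distrib diff_divide_distrib right_diff_distrib)
  then show ?thesis
    unfolding lhs by (simp add: power2_eq_square algebra_simps)
qed

section \<open>Transfer to the cube\<close>

definition cube_point :: "nat \<Rightarrow> nat set \<Rightarrow> nat \<Rightarrow> nat" where
  "cube_point n X = (\<lambda>i\<in>{1..n}. if i \<in> X then 1 else 0)"

lemma bij_betw_cube_point: "bij_betw (cube_point n) (Pow {1..n}) (cube n)"
proof (rule bij_betw_byWitness[where f' = "\<lambda>x. {i\<in>{1..n}. x i = 1}"])
  show "\<forall>x\<in>cube n. cube_point n {i\<in>{1..n}. x i = 1} = x"
    by (auto simp: cube_def cube_point_def fun_eq_iff restrict_def PiE_def Pi_def extensional_def)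
qed (auto simp: cube_def cube_point_def split: if_splits)

lemma cube_point_in_cube: "X \<subseteq> {1..n} \<Longrightarrow> cube_point n X \<in> cube n"
  using bij_betw_cube_point by (auto simp: bij_betw_def)

lemma cube_expectation_eq_sum:
  "cube_expectation n h = (\<Sum>X\<in>Pow {1..n}. h (cube_point n X)) / 2 ^ n"
proof -
  have fin: "finite (cube n)" "cube n \<noteq> {}" and card: "card (cube n) = 2 ^ n"
    using bij_betw_finite[OF bij_betw_cube_point] bij_betw_same_card[OF bij_betw_cube_point, of n]
      cube_point_in_cube[of "{}" n]
    by (auto simp: card_Pow)
  have "cube_expectation n h = (\<Sum>x\<in>cube n. h x) / 2 ^ n"
    using fin by (simp add: cube_expectation_def integral_pmf_of_set card)
  then show ?thesis
    using sum.reindex_bij_betw[OF bij_betw_cube_point, of h n] by simp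
qed

definition cube_support :: "nat \<Rightarrow> ((nat \<Rightarrow> nat) \<Rightarrow> real) \<Rightarrow> nat set set" where
  "cube_support n f = {X. X \<subseteq> {1..n} \<and> f (cube_point n X) = 1}"

lemma cube_supportD: "X \<in> cube_support n f \<Longrightarrow> i \<in> X \<Longrightarrow> i \<in> {1..n}"
  by (auto simp: cube_support_def)

lemma cube_point_value:
  assumes "f \<in> cube n \<rightarrow> {0, 1}" "X \<subseteq> {1..n}"
  shows "f (cube_point n X) = (if X \<in> cube_support n f then 1 else 0)"
  using funcset_mem[OF assms(1) cube_point_in_cube[OF assms(2)]] assms(2)
  by (auto simp: cube_support_def)

lemma fourier_coeff_eq_walsh_coeff:
  assumes "f \<in> cube n \<rightarrow> {0, 1}" "S \<subseteq> {1..n}"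
  shows "fourier_coeff n f S = walsh_coeff {1..n} (cube_support n f) S"
proof -
  have "finite S" using assms(2) finite_subset by blast
  then have char: "cube_char S (cube_point n X) = walsh S X" for X
  proof -
    have "(\<Sum>i\<in>S. cube_point n X i) = (\<Sum>i\<in>S. if i \<in> X then 1 else 0)"
      using assms(2) by (intro sum.cong) (auto simp: cube_point_def)
    also have "\<dots> = card (S \<inter> X)" using \<open>finite S\<close> by (simp add: sum.If_cases)
    finally show ?thesis by (simp add: cube_char_def walsh_def)
  qed
  have "(\<Sum>X\<in>Pow {1..n}. f (cube_point n X) * walsh S X)
      = (\<Sum>X\<in>Pow {1..n}. if X \<in> cube_support n f then walsh S X else 0)"
    by (intro sum.cong) (auto simp: cube_point_value[OF assms(1)])
  also have "\<dots> = (\<Sum>X\<in>cube_support n f. walsh S X)"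
    by (intro sum.mono_neutral_cong_right) (auto dest: cube_supportD)
  finally have "(\<Sum>X\<in>Pow {1..n}. f (cube_point n X) * walsh S X)
      = (\<Sum>X\<in>cube_support n f. walsh S X)" .
  then show ?thesis
    by (simp add: fourier_coeff_def walsh_coeff_def cube_expectation_eq_sum char)
qed

lemma upset_cube_support:
  assumes f: "f \<in> cube n \<rightarrow> {0, 1}" and "cube_increasing n f"
  shows "upset_in {1..n} (cube_support n f)"
proof -
  have step: "f (cube_point n X) \<le> f (cube_point n (insert i X))"
    if "X \<subseteq> {1..n}" "i \<in> {1..n}" "i \<notin> X" for X i
  proof -
    have "(cube_point n X)(i := 0) = cube_point n X"
      "(cube_point n X)(i := 1) = cube_point n (insert i X)"
      using that by (auto simp: cube_point_def fun_eq_iff)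
    then show ?thesis
      using assms(2) cube_point_in_cube[OF that(1)] that(2) by (metis cube_increasing_def)
  qed
  have mono: "f (cube_point n X) \<le> f (cube_point n (X \<union> D))"
    if "finite D" "X \<subseteq> {1..n}" "D \<subseteq> {1..n}" for X D
    using that
  proof (induction D rule: finite_induct)
    case (insert i D)
    then have "f (cube_point n X) \<le> f (cube_point n (X \<union> D))" by simp
    also have "\<dots> \<le> f (cube_point n (insert i (X \<union> D)))"
      using step[of "X \<union> D" i] insert.prems by (cases "i \<in> X \<union> D") (auto simp: insert_absorb)
    finally show ?case by simp
  qed simp
  have "f (cube_point n Y) = 1" if "X \<subseteq> Y" "Y \<subseteq> {1..n}" "f (cube_point n X) = 1" for X Y
  proof -
    have "X \<union> Y = Y" "finite Y" "X \<subseteq> {1..n}" using that finite_subset by auto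
    then have "1 \<le> f (cube_point n Y)" using mono[of Y X] that by simp
    then show ?thesis using cube_point_value[OF f that(2)] by (auto split: if_splits)
  qed
  then show ?thesis by (auto simp: upset_in_def cube_support_def)
qed

lemma expectation_indicator:
  assumes "\<And>X. X \<subseteq> {1..n} \<Longrightarrow> h (cube_point n X) = (if X \<in> F then 1 else 0)" "F \<subseteq> Pow {1..n}"
  shows "cube_expectation n h = card F / 2 ^ n"
proof -
  have "(\<Sum>X\<in>Pow {1..n}. h (cube_point n X)) = (\<Sum>X\<in>F. 1)"
    using assms by (intro sum.mono_neutral_cong_right) auto
  then show ?thesis by (simp add: cube_expectation_eq_sum)
qed

lemma cube_expectation_boolean:
  assumes "f \<in> cube n \<rightarrow> {0, 1}"
  shows "cube_expectation n f = card (cube_support n f) / 2 ^ n"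
  by (rule expectation_indicator) (auto simp: cube_point_value[OF assms] dest: cube_supportD)

lemma cube_cov_eq:
  assumes f: "f \<in> cube n \<rightarrow> {0, 1}" and g: "g \<in> cube n \<rightarrow> {0, 1}"
  shows "cube_cov n f g = card (cube_support n f \<inter> cube_support n g) / 2 ^ n
       - card (cube_support n f) / 2 ^ n * (card (cube_support n g) / 2 ^ n)"
proof -
  have "cube_expectation n (\<lambda>x. f x * g x) = card (cube_support n f \<inter> cube_support n g) / 2 ^ n"
    by (rule expectation_indicator)
      (auto simp: cube_point_value[OF f] cube_point_value[OF g] dest: cube_supportD)
  then show ?thesis by (simp add: cube_cov_def cube_expectation_boolean f g)
qed

text \<open>
  The substitution \<open>x \<mapsto> 1 - x\<close> moves the complement from \<open>g\<close> to \<open>f\<close>, which gives the family of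
  \<open>Y\<close> in the support of \<open>g\<close> whose complement lies in the support of \<open>f\<close>.
\<close>
lemma cube_cov_dual_eq:
  assumes f: "f \<in> cube n \<rightarrow> {0, 1}" and g: "g \<in> cube n \<rightarrow> {0, 1}"
  shows "cube_cov n f (cube_dual n g) = card (cube_support n f) / 2 ^ n * (card (cube_support n g) / 2 ^ n)
       - card {Y \<in> cube_support n g. {1..n} - Y \<in> cube_support n f} / 2 ^ n"
proof -
  let ?F = "cube_support n f" and ?G = "cube_support n g" and ?A = "{1..n}"
  let ?H = "{Y\<in>?G. ?A - Y \<in> ?F}"
  have compl: "cube_compl n (cube_point n X) = cube_point n (?A - X)" for X
    by (auto simp: cube_compl_def cube_point_def fun_eq_iff)
  have reindex: "(\<Sum>X\<in>Pow ?A. h (?A - X)) = (\<Sum>X\<in>Pow ?A. h X)" for h :: "nat set \<Rightarrow> real"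
    by (rule sum.reindex_bij_witness[of _ "\<lambda>X. ?A - X" "\<lambda>X. ?A - X"])
      (auto simp: double_diff)
  note Ef = cube_expectation_boolean[OF f] and Eg = cube_expectation_boolean[OF g]
  have "cube_expectation n (cube_dual n g) = 1 - cube_expectation n g"
    using reindex[of "\<lambda>X. g (cube_point n X)"]
    by (simp add: cube_expectation_eq_sum cube_dual_def compl sum_subtractf card_Pow
        diff_divide_distrib)
  moreover have "cube_expectation n (\<lambda>x. f x * cube_dual n g x)
      = card ?F / 2 ^ n - card ?H / 2 ^ n"
  proof -
    have "cube_expectation n (\<lambda>x. f x * cube_dual n g x)
        = cube_expectation n f - cube_expectation n (\<lambda>x. f (cube_compl n x) * g x)"
    proof -
      have "(\<Sum>X\<in>Pow ?A. f (cube_point n X) * g (cube_point n (?A - X)))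
          = (\<Sum>X\<in>Pow ?A. f (cube_point n (?A - X)) * g (cube_point n X))"
        using reindex[of "\<lambda>X. f (cube_point n (?A - X)) * g (cube_point n X)"]
        by (simp add: double_diff)
      then show ?thesis
        by (simp add: cube_expectation_eq_sum cube_dual_def compl right_diff_distrib
            sum_subtractf diff_divide_distrib)
    qed
    also have "cube_expectation n (\<lambda>x. f (cube_compl n x) * g x) = card ?H / 2 ^ n"
      by (rule expectation_indicator)
        (auto simp: compl cube_point_value[OF f] cube_point_value[OF g] dest: cube_supportD)
    finally show ?thesis by (simp add: Ef)
  qed
  ultimately show ?thesis
    by (simp add: cube_cov_def Ef Eg right_diff_distrib)
qed

theorem theorem1p4:
  fixes n :: nat and f g :: "(nat \<Rightarrow> nat) \<Rightarrow> real" and t :: real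
  assumes "n \<ge> 1"
    and "f \<in> cube n \<rightarrow> {0, 1}" and "g \<in> cube n \<rightarrow> {0, 1}"
    and "cube_increasing n f" and "cube_increasing n g"
  shows "2 * (\<Sum>(S, T) \<in> {(S, T). S \<subseteq> {1..n} \<and> T \<subseteq> {1..n} \<and> odd (card (S \<inter> T))}.
             (fourier_coeff n f S)\<^sup>2 * (fourier_coeff n g T)\<^sup>2)
         \<le> t\<^sup>2 * cube_cov n f g + (1 - t)\<^sup>2 * cube_cov n f (cube_dual n g)"
proof -
  let ?F = "cube_support n f" and ?G = "cube_support n g" and ?A = "{1..n}"
  have "(\<Sum>(S, T) \<in> {(S, T). S \<subseteq> ?A \<and> T \<subseteq> ?A \<and> odd (card (S \<inter> T))}.
             (fourier_coeff n f S)\<^sup>2 * (fourier_coeff n g T)\<^sup>2)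
      = (\<Sum>(S, T) \<in> {(S, T). S \<subseteq> ?A \<and> T \<subseteq> ?A \<and> odd (card (S \<inter> T))}.
             (walsh_coeff ?A ?F S)\<^sup>2 * (walsh_coeff ?A ?G T)\<^sup>2)"
    by (rule sum.cong) (auto simp: fourier_coeff_eq_walsh_coeff assms)
  then show ?thesis
    using upset_inequality[of ?A ?F ?G t] upset_cube_support assms
    by (simp add: cube_cov_eq cube_cov_dual_eq)
qed

end
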